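(* Let $L$ be an MI-lattice and $I$ an ideal of $L$. Then the ordered set $L_I$ on $I\cup\{\hat{1}\}$ with the order induced from $L$ (where $\hat{1}$ is the greatest element of $L$) is a lattice that is MI-orderable.
   Context: Lattices are finite. An ideal of an ordered set $P$ is a subset $I$ such that $x\in I$ and $y\le x$ imply $y\in I$. An MI-ordering of an antichain $\mathcal{A}$ in a lattice $L$ is a listing $a_1,\ldots,a_t$ of the elements of $\mathcal{A}$ such that (i) $a_i\lor a_{i+1}\lor\cdots\lor a_k=a_i\lor a_k$ for all $1\le i<k\le t$, and (ii) $(a_1\land\cdots\land a_k)\lor a_{k+1}=a_k\lor a_{k+1}$ for all $1<k<t$. An antichain is MI-orderable if it has an MI-ordering; a lattice is an MI-lattice (MI-orderable) if all of its antichains are MI-orderable. *)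

theory Defs
  imports "HOL-Algebra.Lattice"
begin

text \<open>
  HOL-Algebra's \<open>lattice\<close> admits an empty carrier, which has no greatest element,
  so nonemptiness is required here.
\<close>

definition finite_lattice :: "('a, 'b) gorder_scheme \<Rightarrow> bool" where
  "finite_lattice L \<longleftrightarrow> lattice L \<and> finite (carrier L) \<and> carrier L \<noteq> {}"

text \<open>Following the ordered-set convention, an ideal is any down-set; it may be empty.\<close>

definition order_ideal :: "('a, 'b) gorder_scheme \<Rightarrow> 'a set \<Rightarrow> bool" where
  "order_ideal P I \<longleftrightarrow>
     I \<subseteq> carrier P \<and> (\<forall>x\<in>I. \<forall>y\<in>carrier P. y \<sqsubseteq>\<^bsub>P\<^esub> x \<longrightarrow> y \<in> I)"

definition antichain :: "('a, 'b) gorder_scheme \<Rightarrow> 'a set \<Rightarrow> bool" where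
  "antichain P A \<longleftrightarrow>
     A \<subseteq> carrier P \<and> (\<forall>x\<in>A. \<forall>y\<in>A. x \<noteq> y \<longrightarrow> \<not> x \<sqsubseteq>\<^bsub>P\<^esub> y)"

text \<open>
  The listing \<open>a\<^sub>1, \<dots>, a\<^sub>t\<close> is a bijection from \<open>{1..t}\<close>; iterated joins and
  meets are the suprema and infima of the corresponding finite nonempty sets.
\<close>

definition MI_ordering :: "('a, 'b) gorder_scheme \<Rightarrow> 'a set \<Rightarrow> nat \<Rightarrow> (nat \<Rightarrow> 'a) \<Rightarrow> bool" where
  "MI_ordering L A t a \<longleftrightarrow>
     bij_betw a {1..t} A \<and>
     (\<forall>i k. 1 \<le> i \<and> i < k \<and> k \<le> t \<longrightarrow>
        \<Squnion>\<^bsub>L\<^esub> (a ` {i..k}) = a i \<squnion>\<^bsub>L\<^esub> a k) \<and>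
     (\<forall>k. 1 < k \<and> k < t \<longrightarrow>
        (\<Sqinter>\<^bsub>L\<^esub> (a ` {1..k})) \<squnion>\<^bsub>L\<^esub> a (k + 1) = a k \<squnion>\<^bsub>L\<^esub> a (k + 1))"

definition MI_orderable :: "('a, 'b) gorder_scheme \<Rightarrow> 'a set \<Rightarrow> bool" where
  "MI_orderable L A \<longleftrightarrow> (\<exists>t a. MI_ordering L A t a)"

definition MI_lattice :: "('a, 'b) gorder_scheme \<Rightarrow> bool" where
  "MI_lattice L \<longleftrightarrow> finite_lattice L \<and> (\<forall>A. antichain L A \<longrightarrow> MI_orderable L A)"

text \<open>
  The order and equality fields of the record are kept, so joins and meets of the
  restricted structure are taken within \<open>I \<union> {\<top>}\<close>.
\<close>

definition ideal_with_top :: "('a, 'b) gorder_scheme \<Rightarrow> 'a set \<Rightarrow> ('a, 'b) gorder_scheme" where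
  "ideal_with_top L I = L\<lparr>carrier := I \<union> {\<top>\<^bsub>L\<^esub>}\<rparr>"

end

theory Submission
  imports Defs
begin

text \<open>
  An MI-ordering in \<open>L\<close> of an antichain of \<open>L\<^sub>I\<close> is also an MI-ordering in \<open>L\<^sub>I\<close>. Meets in
  \<open>L\<^sub>I\<close> agree with those of \<open>L\<close>. A join in \<open>L\<^sub>I\<close> is determined by the upper bounds lying in
  \<open>L\<^sub>I\<close>; two sets with equal joins in \<open>L\<close> have the same upper bounds in \<open>L\<close>, hence also in
  \<open>L\<^sub>I\<close>, and therefore have equal joins in \<open>L\<^sub>I\<close>.
\<close>

text \<open>The constant \<open>top\<close> is defined by choice, so it is greatest as soon as some
  greatest element exists. The join of the finite nonempty carrier is one.\<close>

lemma finite_lattice_greatest_top: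
  assumes "finite_lattice L"
  shows "greatest L \<top>\<^bsub>L\<^esub> (carrier L)"
proof -
  interpret lattice L using assms by (simp add: finite_lattice_def)
  have "least L (\<Squnion>\<^bsub>L\<^esub> (carrier L)) (Upper L (carrier L))"
    using assms by (intro finite_sup_least) (auto simp: finite_lattice_def)
  then have "greatest L (\<Squnion>\<^bsub>L\<^esub> (carrier L)) (carrier L)"
    by (auto simp: least_def greatest_def Upper_def)
  then show ?thesis
    unfolding top_def by (rule someI)
qed

lemma Upper_restrict_carrier:
  assumes "C \<subseteq> carrier L" "A \<subseteq> C"
  shows "Upper (L\<lparr>carrier := C\<rparr>) A = Upper L A \<inter> C"
  using assms by (auto simp: Upper_def)

lemma Lower_restrict_carrier:
  assumes "C \<subseteq> carrier L" "A \<subseteq> C"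
  shows "Lower (L\<lparr>carrier := C\<rparr>) A = Lower L A \<inter> C"
  using assms by (auto simp: Lower_def)

lemma partial_order_restrict_carrier:
  assumes "partial_order L" "C \<subseteq> carrier L"
  shows "partial_order (L\<lparr>carrier := C\<rparr>)"
proof -
  interpret partial_order L by fact
  interpret R: weak_partial_order "L\<lparr>carrier := C\<rparr>"
    using weak_partial_order_axioms assms(2) by (rule weak_partial_order_subset)
  show ?thesis
    by unfold_locales (simp add: eq_is_equal)
qed

text \<open>By transitivity everything above \<open>s\<close> bounds \<open>A\<close>. The join
  alone thus determines all upper bounds, which turns equal joins into equal sets of upper
  bounds.\<close>

lemma (in weak_partial_order) Upper_eq_above_least:
  assumes "A \<subseteq> carrier L" "least L s (Upper L A)"
  shows "Upper L A = {u \<in> carrier L. s \<sqsubseteq> u}"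
proof -
  have "s \<in> carrier L" using assms(2) by (auto simp: least_def Upper_def)
  then show ?thesis
    using assms le_trans unfolding least_def Upper_def by blast
qed

lemma (in upper_semilattice) sup_restrict_carrier_cong:
  assumes "C \<subseteq> carrier L"
    and "finite A" "A \<noteq> {}" "A \<subseteq> C" "finite B" "B \<noteq> {}" "B \<subseteq> C"
    and "\<Squnion> A = \<Squnion> B"
  shows "\<Squnion>\<^bsub>L\<lparr>carrier := C\<rparr>\<^esub> A = \<Squnion>\<^bsub>L\<lparr>carrier := C\<rparr>\<^esub> B"
proof -
  have "A \<subseteq> carrier L" "B \<subseteq> carrier L"
    using assms by auto
  then have "Upper L A = Upper L B"
    using assms Upper_eq_above_least[OF _ finite_sup_least] by metis
  then show ?thesis
    \<comment> \<open>The constant \<open>sup\<close> is a choice depending only on which elements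
      are least in \<open>Upper\<close>, so equal sets of upper bounds give equal values even before
      a join in the restricted order is known to exist.\<close>
    using assms by (simp add: sup_def Upper_restrict_carrier)
qed

lemma ideal_with_top_subset_carrier:
  assumes "finite_lattice L" "order_ideal L I"
  shows "I \<union> {\<top>\<^bsub>L\<^esub>} \<subseteq> carrier L"
  using finite_lattice_greatest_top[OF assms(1)] assms(2)
  by (auto simp: order_ideal_def greatest_def)

text \<open>If \<open>A\<close> meets \<open>I\<close>, its meet lies below an element of the
  down-set \<open>I\<close>. Otherwise \<open>A\<close> consists of the top alone, which is then its
  own meet.\<close>

lemma inf_mem_ideal_with_top:
  assumes "finite_lattice L" "order_ideal L I"
    and A: "finite A" "A \<noteq> {}" "A \<subseteq> I \<union> {\<top>\<^bsub>L\<^esub>}"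
  shows "\<Sqinter>\<^bsub>L\<^esub> A \<in> I \<union> {\<top>\<^bsub>L\<^esub>}"
proof -
  interpret lattice L using assms(1) by (simp add: finite_lattice_def)
  have C: "I \<union> {\<top>\<^bsub>L\<^esub>} \<subseteq> carrier L"
    using assms(1,2) by (rule ideal_with_top_subset_carrier)
  have "A \<subseteq> carrier L" using A C by blast
  then have g: "greatest L (\<Sqinter>\<^bsub>L\<^esub> A) (Lower L A)"
    using A by (intro finite_inf_greatest)
  have g_le: "\<Sqinter>\<^bsub>L\<^esub> A \<in> carrier L" "\<And>x. x \<in> A \<Longrightarrow> \<Sqinter>\<^bsub>L\<^esub> A \<sqsubseteq>\<^bsub>L\<^esub> x"
    using g \<open>A \<subseteq> carrier L\<close> by (auto simp: greatest_def Lower_def)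
  show ?thesis
  proof (cases "A \<inter> I = {}")
    case True
    then have "A = {\<top>\<^bsub>L\<^esub>}" using A by blast
    moreover have "\<top>\<^bsub>L\<^esub> \<in> carrier L" using C by simp
    ultimately show ?thesis
      using weak_inf_of_singleton eq_is_equal by simp
  next
    case False
    then show ?thesis
      using g_le assms(2) unfolding order_ideal_def by blast
  qed
qed

text \<open>Restriction only shrinks the set of lower bounds, and a greatest element stays greatest
  in any subset that still contains it.\<close>

lemma greatest_Lower_ideal_with_top:
  assumes "finite_lattice L" "order_ideal L I"
    and A: "finite A" "A \<noteq> {}" "A \<subseteq> I \<union> {\<top>\<^bsub>L\<^esub>}"
  shows "greatest (ideal_with_top L I) (\<Sqinter>\<^bsub>L\<^esub> A) (Lower (ideal_with_top L I) A)"
proof -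
  interpret lattice L using assms(1) by (simp add: finite_lattice_def)
  have C: "I \<union> {\<top>\<^bsub>L\<^esub>} \<subseteq> carrier L"
    using assms(1,2) by (rule ideal_with_top_subset_carrier)
  have "greatest L (\<Sqinter>\<^bsub>L\<^esub> A) (Lower L A)"
    using A C by (intro finite_inf_greatest) auto
  then show ?thesis
    using inf_mem_ideal_with_top[OF assms] Lower_restrict_carrier[OF C A(3)]
    unfolding ideal_with_top_def greatest_def by auto
qed

lemma least_Upper_ideal_with_top:
  assumes "finite_lattice L" "order_ideal L I"
    and A: "finite A" "A \<noteq> {}" "A \<subseteq> I \<union> {\<top>\<^bsub>L\<^esub>}"
  shows "\<exists>s. least (ideal_with_top L I) s (Upper (ideal_with_top L I) A)"
proof -
  let ?C = "I \<union> {\<top>\<^bsub>L\<^esub>}" and ?s = "\<Squnion>\<^bsub>L\<^esub> A"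
  interpret lattice L using assms(1) by (simp add: finite_lattice_def)
  have C: "?C \<subseteq> carrier L"
    using assms(1,2) by (rule ideal_with_top_subset_carrier)
  have AL: "A \<subseteq> carrier L" using A C by blast
  have s: "least L ?s (Upper L A)"
    using A AL by (intro finite_sup_least)
  have sL: "?s \<in> carrier L" using A AL by simp
  have U: "Upper (L\<lparr>carrier := ?C\<rparr>) A = {u \<in> ?C. ?s \<sqsubseteq>\<^bsub>L\<^esub> u}"
    using Upper_restrict_carrier[OF C A(3)] Upper_eq_above_least[OF AL s] C by auto
  have top: "?s \<sqsubseteq>\<^bsub>L\<^esub> \<top>\<^bsub>L\<^esub>"
    using finite_lattice_greatest_top[OF assms(1)] sL by (auto simp: greatest_def)
  \<comment> \<open>The join formed in \<open>L\<close> is kept when it falls into \<open>I\<close>;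
    any other join is pushed up to the top.\<close>
  have "least (L\<lparr>carrier := ?C\<rparr>) (if ?s \<in> I then ?s else \<top>\<^bsub>L\<^esub>) {u \<in> ?C. ?s \<sqsubseteq>\<^bsub>L\<^esub> u}"
  proof (cases "?s \<in> I")
    case True
    then show ?thesis using sL by (auto simp: least_def)
  next
    case False
    \<comment> \<open>An element of \<open>I\<close> above the join would force the join into the
      down-set \<open>I\<close>, so only the top remains as an upper bound.\<close>
    then have "{u \<in> ?C. ?s \<sqsubseteq>\<^bsub>L\<^esub> u} = {\<top>\<^bsub>L\<^esub>}"
      using assms(2) sL top unfolding order_ideal_def by blast
    then show ?thesis using False C by (simp add: least_def)
  qed
  then show ?thesis
    unfolding ideal_with_top_def U by blast
qed

lemma lattice_ideal_with_top:
  assumes "finite_lattice L" "order_ideal L I"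
  shows "lattice (ideal_with_top L I)"
proof -
  interpret L: lattice L using assms(1) by (simp add: finite_lattice_def)
  interpret partial_order "ideal_with_top L I"
    unfolding ideal_with_top_def
    using L.partial_order_axioms ideal_with_top_subset_carrier[OF assms]
    by (rule partial_order_restrict_carrier)
  have carr: "carrier (ideal_with_top L I) = I \<union> {\<top>\<^bsub>L\<^esub>}"
    by (simp add: ideal_with_top_def)
  show ?thesis
  proof
    fix x y assume "x \<in> carrier (ideal_with_top L I)" "y \<in> carrier (ideal_with_top L I)"
    then have xy: "finite {x, y}" "{x, y} \<noteq> {}" "{x, y} \<subseteq> I \<union> {\<top>\<^bsub>L\<^esub>}"
      by (auto simp: carr)
    show "\<exists>s. least (ideal_with_top L I) s (Upper (ideal_with_top L I) {x, y})"
      using assms xy by (rule least_Upper_ideal_with_top)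
    show "\<exists>s. greatest (ideal_with_top L I) s (Lower (ideal_with_top L I) {x, y})"
      using greatest_Lower_ideal_with_top[OF assms xy] by blast
  qed
qed

lemma inf_ideal_with_top:
  assumes "finite_lattice L" "order_ideal L I"
    and "finite A" "A \<noteq> {}" "A \<subseteq> I \<union> {\<top>\<^bsub>L\<^esub>}"
  shows "\<Sqinter>\<^bsub>ideal_with_top L I\<^esub> A = \<Sqinter>\<^bsub>L\<^esub> A"
proof -
  interpret lattice "ideal_with_top L I"
    using assms(1,2) by (rule lattice_ideal_with_top)
  have "greatest (ideal_with_top L I) (\<Sqinter>\<^bsub>L\<^esub> A) (Lower (ideal_with_top L I) A)"
    using assms by (rule greatest_Lower_ideal_with_top)
  then show ?thesis
    \<comment> \<open>The meet is again a choice; antisymmetry in the restricted order makes the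
      greatest lower bound unique, so the choice must return the meet of \<open>L\<close>.\<close>
    unfolding inf_def[of "ideal_with_top L I"]
    by (metis greatest_unique someI_ex)
qed

lemma MI_ordering_ideal_with_top:
  assumes "finite_lattice L" "order_ideal L I"
    and "A \<subseteq> I \<union> {\<top>\<^bsub>L\<^esub>}" and MI: "MI_ordering L A t a"
  shows "MI_ordering (ideal_with_top L I) A t a"
proof -
  let ?C = "I \<union> {\<top>\<^bsub>L\<^esub>}"
  interpret lattice L using assms(1) by (simp add: finite_lattice_def)
  have C: "?C \<subseteq> carrier L"
    using assms(1,2) by (rule ideal_with_top_subset_carrier)
  have bij: "bij_betw a {1..t} A"
    using MI by (simp add: MI_ordering_def)
  then have aC: "a i \<in> ?C" if "1 \<le> i" "i \<le> t" for i
    using that assms(3) bij_betwE by fastforce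
  \<comment> \<open>Both conditions of an MI-ordering equate two joins, a binary join being the
    \<open>sup\<close> of a pair, so this single rule transfers them both.\<close>
  have sup_cong: "\<Squnion>\<^bsub>ideal_with_top L I\<^esub> X = \<Squnion>\<^bsub>ideal_with_top L I\<^esub> Y"
    if "finite X" "X \<noteq> {}" "X \<subseteq> ?C" "finite Y" "Y \<noteq> {}" "Y \<subseteq> ?C" "\<Squnion>\<^bsub>L\<^esub> X = \<Squnion>\<^bsub>L\<^esub> Y" for X Y
    unfolding ideal_with_top_def using C that by (rule sup_restrict_carrier_cong)
  have "\<Squnion>\<^bsub>ideal_with_top L I\<^esub> (a ` {i..k}) = a i \<squnion>\<^bsub>ideal_with_top L I\<^esub> a k"
    if ik: "1 \<le> i" "i < k" "k \<le> t" for i k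
    unfolding join_def
  proof (rule sup_cong)
    show "a ` {i..k} \<subseteq> ?C"
      using ik by (intro image_subsetI aC) auto
    show "{a i, a k} \<subseteq> ?C"
      using aC[of i] aC[of k] ik by simp
    show "\<Squnion>\<^bsub>L\<^esub> (a ` {i..k}) = \<Squnion>\<^bsub>L\<^esub> {a i, a k}"
      using MI ik by (simp add: MI_ordering_def join_def)
  qed (use ik in auto)
  moreover have "\<Sqinter>\<^bsub>ideal_with_top L I\<^esub> (a ` {1..k}) \<squnion>\<^bsub>ideal_with_top L I\<^esub> a (k + 1)
      = a k \<squnion>\<^bsub>ideal_with_top L I\<^esub> a (k + 1)"
    if k: "1 < k" "k < t" for k
  proof -
    have "a ` {1..k} \<subseteq> ?C"
      using k by (intro image_subsetI aC) auto
    then have P: "finite (a ` {1..k})" "a ` {1..k} \<noteq> {}" "a ` {1..k} \<subseteq> ?C"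
      using k by auto
    \<comment> \<open>The inner meet is first replaced by the meet of \<open>L\<close>; its
      membership in \<open>?C\<close> then allows the outer join to be transferred.\<close>
    note m = inf_ideal_with_top[OF assms(1,2) P] inf_mem_ideal_with_top[OF assms(1,2) P]
    show ?thesis
      unfolding join_def m(1)
    proof (rule sup_cong)
      show "{\<Sqinter>\<^bsub>L\<^esub> (a ` {1..k}), a (k + 1)} \<subseteq> ?C" "{a k, a (k + 1)} \<subseteq> ?C"
        using m(2) aC[of k] aC[of "k + 1"] k by auto
      show "\<Squnion>\<^bsub>L\<^esub> {\<Sqinter>\<^bsub>L\<^esub> (a ` {1..k}), a (k + 1)} = \<Squnion>\<^bsub>L\<^esub> {a k, a (k + 1)}"
        using MI k by (simp add: MI_ordering_def join_def)
    qed auto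
  qed
  ultimately show ?thesis
    using bij by (simp add: MI_ordering_def)
qed

theorem theorem5p1:
  fixes L :: "('a, 'b) gorder_scheme" and I :: "'a set"
  assumes "MI_lattice L"
    and "order_ideal L I"
  shows "lattice (ideal_with_top L I) \<and> MI_lattice (ideal_with_top L I)"
proof -
  have fin: "finite_lattice L"
    using assms(1) by (simp add: MI_lattice_def)
  note C = ideal_with_top_subset_carrier[OF fin assms(2)]
  have lat: "lattice (ideal_with_top L I)"
    using fin assms(2) by (rule lattice_ideal_with_top)
  have "finite (I \<union> {\<top>\<^bsub>L\<^esub>})"
    using fin C by (auto simp: finite_lattice_def intro: finite_subset)
  \<comment> \<open>Since \<open>I\<close> may be empty, it is the adjoined top that keeps the
    carrier nonempty.\<close>
  with lat have "finite_lattice (ideal_with_top L I)"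
    by (simp add: finite_lattice_def ideal_with_top_def)
  moreover have "MI_orderable (ideal_with_top L I) A" if "antichain (ideal_with_top L I) A" for A
  proof -
    \<comment> \<open>The order relation is that of \<open>L\<close>, so incomparability is the same
      in both structures.\<close>
    have A: "A \<subseteq> I \<union> {\<top>\<^bsub>L\<^esub>}" and "antichain L A"
      using that C by (auto simp: antichain_def ideal_with_top_def)
    then obtain t a where "MI_ordering L A t a"
      using assms(1) by (auto simp: MI_lattice_def MI_orderable_def)
    then show ?thesis
      using MI_ordering_ideal_with_top[OF fin assms(2) A] by (auto simp: MI_orderable_def)
  qed
  ultimately show ?thesis
    using lat by (simp add: MI_lattice_def)
qed

end
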